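(* Let $a:[0,1]\to[0,\infty)$ be continuous and suppose there is a point $x_0\in[0,1]$ such that $a(x_0)=0$, $a>0$ on $[0,1]\setminus\{x_0\}$ and $\frac1a\in L^1(0,1)$. Then, for $i=1,2$, the spaces $H^i_{\frac1a}(0,1)$ and $H^i_0(0,1)$ coincide algebraically and their norms are equivalent. Moreover, if $u\in H^2_0(0,1)$ (i.e. $u\in H^2_{\frac1a}(0,1)$), then $(au)(x_0)=(au')(x_0)=0$.
   Context: Functions are real valued. $L^2_{\frac1a}(0,1):=\{u\in L^2(0,1): \int_0^1 \frac{u^2}{a}\,dx<+\infty\}$ with norm $\|u\|^2_{L^2_{1/a}(0,1)}=\int_0^1\frac{u^2}{a}\,dx$. For $i=1,2$: $H^i_0(0,1):=\{u\in H^i(0,1): u^{(k)}(j)=0,\ j=0,1,\ k=0,\dots,i-1\}$ with its usual Sobolev norm, and $H^i_{\frac1a}(0,1):=L^2_{\frac1a}(0,1)\cap H^i_0(0,1)$ with the norm $\|u\|_i^2:=\|u\|^2_{L^2_{1/a}(0,1)}+\|u^{(i)}\|^2_{L^2(0,1)}$ (which is equivalent to $\|u\|^2_{L^2_{1/a}(0,1)}+\sum_{k=1}^i\|u^{(k)}\|^2_{L^2(0,1)}$). *)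

theory Defs
  imports "HOL-Analysis.Analysis"
begin

(* Elements of function spaces are represented by functions real => real, of which only the
   restriction to (0,1) matters, and that only up to Lebesgue null sets: every set of functions
   below is closed under equality a.e. on (0,1) and every norm below is invariant under it.
   Equality of two such sets is therefore equality of the spaces of equivalence classes, and
   the linear operations are the pointwise ones throughout. *)

abbreviation leb01 :: "real measure" where
  "leb01 \<equiv> lebesgue_on {0<..<1}"

definition L1 :: "(real \<Rightarrow> real) set" where
  "L1 = {u. integrable leb01 u}"

definition L2 :: "(real \<Rightarrow> real) set" where
  "L2 = {u. u \<in> borel_measurable leb01 \<and> integrable leb01 (\<lambda>x. (u x)\<^sup>2)}"

definition L2_norm :: "(real \<Rightarrow> real) \<Rightarrow> real" where
  "L2_norm u = sqrt (integral\<^sup>L leb01 (\<lambda>x. (u x)\<^sup>2))"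

(* The quotient by a only needs to make sense a.e.; where a vanishes, HOL's x / 0 = 0 applies. *)

definition L2w :: "(real \<Rightarrow> real) \<Rightarrow> (real \<Rightarrow> real) set" where
  "L2w a = {u \<in> L2. integrable leb01 (\<lambda>x. (u x)\<^sup>2 / a x)}"

definition L2w_norm :: "(real \<Rightarrow> real) \<Rightarrow> (real \<Rightarrow> real) \<Rightarrow> real" where
  "L2w_norm a u = sqrt (integral\<^sup>L leb01 (\<lambda>x. (u x)\<^sup>2 / a x))"

definition test_functions :: "(real \<Rightarrow> real) set" where
  "test_functions = {\<phi>. (\<forall>n x. (deriv ^^ n) \<phi> differentiable (at x)) \<and>
                        (\<exists>c d. 0 < c \<and> d < 1 \<and> (\<forall>x. x \<notin> {c..d} \<longrightarrow> \<phi> x = 0))}"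

definition has_weak_deriv :: "nat \<Rightarrow> (real \<Rightarrow> real) \<Rightarrow> (real \<Rightarrow> real) \<Rightarrow> bool" where
  "has_weak_deriv k u v \<longleftrightarrow> u \<in> L2 \<and> v \<in> L2 \<and>
     (\<forall>\<phi>\<in>test_functions.
        integral\<^sup>L leb01 (\<lambda>x. u x * (deriv ^^ k) \<phi> x) =
        (-1) ^ k * integral\<^sup>L leb01 (\<lambda>x. v x * \<phi> x))"

(* A representative of the weak derivative; it is determined up to null sets whenever a weak
   derivative in L2 exists, and is used only in that case. *)

definition weak_deriv :: "nat \<Rightarrow> (real \<Rightarrow> real) \<Rightarrow> real \<Rightarrow> real" where
  "weak_deriv k u = (SOME v. has_weak_deriv k u v)"

definition H :: "nat \<Rightarrow> (real \<Rightarrow> real) set" where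
  "H i = {u \<in> L2. \<forall>k\<le>i. \<exists>v. has_weak_deriv k u v}"

definition H_norm :: "nat \<Rightarrow> (real \<Rightarrow> real) \<Rightarrow> real" where
  "H_norm i u = sqrt (\<Sum>k\<le>i. (L2_norm (weak_deriv k u))\<^sup>2)"

(* Pointwise value at x in [0,1] of a class of functions: the class has a representative that is
   continuous on the closed interval (necessarily unique there), and this takes the value c at x. *)

definition has_value_at :: "(real \<Rightarrow> real) \<Rightarrow> real \<Rightarrow> real \<Rightarrow> bool" where
  "has_value_at f x c \<longleftrightarrow>
     (\<exists>w. continuous_on {0..1} w \<and> (AE y in leb01. f y = w y) \<and> w x = c)"

definition H0 :: "nat \<Rightarrow> (real \<Rightarrow> real) set" where
  "H0 i = {u \<in> H i. \<forall>k<i. has_value_at (weak_deriv k u) 0 0 \<and> has_value_at (weak_deriv k u) 1 0}"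

definition Hw :: "(real \<Rightarrow> real) \<Rightarrow> nat \<Rightarrow> (real \<Rightarrow> real) set" where
  "Hw a i = L2w a \<inter> H0 i"

definition Hw_norm :: "(real \<Rightarrow> real) \<Rightarrow> nat \<Rightarrow> (real \<Rightarrow> real) \<Rightarrow> real" where
  "Hw_norm a i u = sqrt ((L2w_norm a u)\<^sup>2 + (L2_norm (weak_deriv i u))\<^sup>2)"

definition equivalent_norms_on ::
    "'v set \<Rightarrow> ('v \<Rightarrow> real) \<Rightarrow> ('v \<Rightarrow> real) \<Rightarrow> bool" where
  "equivalent_norms_on V N N' \<longleftrightarrow>
     (\<exists>c C. 0 < c \<and> 0 < C \<and> (\<forall>u\<in>V. c * N u \<le> N' u \<and> N' u \<le> C * N u))"

end

(*
A function u on (0,1) with weak derivative v in L^2 and boundary value 0 at the left end point equals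
x |-> (integral of v over (0,x)) almost everywhere, so |u| <= ||v||_2 a.e.  Hence ||u||_2 <= ||v||_2
and the integral of u^2/a is at most ||1/a||_1 ||v||_2^2; for i = 2 the same applies to u', whose weak
derivative is u''.  So both norms are equivalent to the L^2 norm of the derivative of order i alone.

For the integral formula, products of two rescaled copies of exp(-1/x) are smooth and converge
boundedly to indicators of intervals.  Testing the weak derivative with the function whose derivative
is such a cutoff minus its translate gives, in the limit, the differences of averages of u over
short intervals; at Lebesgue points these averages converge to the values of u.
*)

theory Submission
  imports Defs
begin

subsection \<open>Smooth cutoff functions\<close>

definition smooth :: "(real \<Rightarrow> real) \<Rightarrow> bool" where
  "smooth f \<longleftrightarrow> (\<forall>n x. (deriv ^^ n) f differentiable (at x))"

text \<open>A family of functions closed under differentiation contains all iterated derivatives of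
  its members. Smoothness thus needs only a family and one differentiation step, not a formula for
  the \<open>n\<close>-th derivative.\<close>

lemma smooth_coinduct:
  assumes "f \<in> S"
    and step: "\<And>g. g \<in> S \<Longrightarrow> \<exists>g'\<in>S. \<forall>x. (g has_real_derivative g' x) (at x)"
  shows "smooth f"
proof -
  have diff: "g differentiable (at x)" if "g \<in> S" for g x
    using step[OF that] by (meson real_differentiable_def)
  have deriv: "deriv g \<in> S" if g: "g \<in> S" for g
  proof -
    obtain g' where g': "g' \<in> S" "\<forall>x. (g has_real_derivative g' x) (at x)"
      using step[OF g] by blast
    then have "deriv g = g'"
      by (auto intro!: DERIV_imp_deriv)
    with g' show ?thesis by simp
  qed
  have "(deriv ^^ n) f \<in> S" for n
    by (induction n) (auto simp: assms(1) deriv)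
  then show ?thesis
    by (simp add: smooth_def diff)
qed

lemma smooth_deriv: "smooth f \<Longrightarrow> smooth (deriv f)"
  unfolding smooth_def by (metis comp_apply funpow_Suc_right)

lemma smooth_has_real_derivative:
  "smooth f \<Longrightarrow> (f has_real_derivative deriv f x) (at x)"
  unfolding smooth_def
  by (metis DERIV_imp_deriv funpow_0 real_differentiable_def)

lemma smooth_continuous_on: "smooth f \<Longrightarrow> continuous_on A f"
  by (meson DERIV_continuous_on has_field_derivative_at_within smooth_has_real_derivative)

text \<open>Adjoining \<open>F\<close> to all smooth functions keeps the family closed, since the
  derivative of \<open>F\<close> is already smooth.\<close>

lemma smooth_antideriv:
  assumes "smooth f" "\<And>x. (F has_real_derivative f x) (at x)"
  shows "smooth F"
proof (rule smooth_coinduct[where S = "insert F {g. smooth g}"])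
  fix g assume "g \<in> insert F {g. smooth g}"
  then show "\<exists>g'\<in>insert F {g. smooth g}. \<forall>x. (g has_real_derivative g' x) (at x)"
    using assms smooth_deriv smooth_has_real_derivative by blast
qed simp

lemma smooth_diff:
  assumes "smooth f" "smooth g"
  shows "smooth (\<lambda>x. f x - g x)"
proof (rule smooth_coinduct[where S = "{\<lambda>x. f x - g x | f g. smooth f \<and> smooth g}"])
  fix h :: "real \<Rightarrow> real" assume "h \<in> {\<lambda>x. f x - g x | f g. smooth f \<and> smooth g}"
  then obtain f g where fg: "smooth f" "smooth g" "h = (\<lambda>x. f x - g x)" by blast
  have "(h has_real_derivative deriv f x - deriv g x) (at x)" for x
    unfolding fg(3) by (intro DERIV_diff smooth_has_real_derivative fg)
  with fg show "\<exists>h'\<in>{\<lambda>x. f x - g x | f g. smooth f \<and> smooth g}. \<forall>x. (h has_real_derivative h' x) (at x)"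
    by (intro bexI[where x = "\<lambda>x. deriv f x - deriv g x"]) (auto intro: smooth_deriv)
qed (use assms in blast)

lemma smooth_affine:
  assumes "smooth f"
  shows "smooth (\<lambda>x. f (m * x + b))"
\<comment> \<open>Scalar factors belong to the family because every use of the chain rule produces
  another factor \<open>m\<close>.\<close>
proof (rule smooth_coinduct[where S = "{\<lambda>x. k * f (m * x + b) | k f. smooth f}"])
  fix h :: "real \<Rightarrow> real" assume "h \<in> {\<lambda>x. k * f (m * x + b) | k f. smooth f}"
  then obtain k f where f: "smooth f" "h = (\<lambda>x. k * f (m * x + b))" by blast
  have "(h has_real_derivative (k * m) * deriv f (m * x + b)) (at x)" for x
    unfolding f(2)
    by (auto intro!: derivative_eq_intros DERIV_chain2[OF smooth_has_real_derivative[OF f(1)]])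
  with f show "\<exists>h'\<in>{\<lambda>x. k * f (m * x + b) | k f. smooth f}. \<forall>x. (h has_real_derivative h' x) (at x)"
    by (intro bexI[where x = "\<lambda>x. (k * m) * deriv f (m * x + b)"]) (auto intro: smooth_deriv)
next
  have "(\<lambda>x. f (m * x + b)) = (\<lambda>x. 1 * f (m * x + b))" by simp
  with assms show "(\<lambda>x. f (m * x + b)) \<in> {\<lambda>x. k * f (m * x + b) | k f. smooth f}" by blast
qed

text \<open>The product rule turns one product into a sum of two, so products alone are not closed
  under differentiation; this is the family for \<open>smooth_coinduct\<close> that is.\<close>

inductive_set sums_of_smooth_products :: "(real \<Rightarrow> real) set" where
  "smooth f \<Longrightarrow> smooth g \<Longrightarrow> (\<lambda>x. f x * g x) \<in> sums_of_smooth_products"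
| "f \<in> sums_of_smooth_products \<Longrightarrow> g \<in> sums_of_smooth_products \<Longrightarrow>
     (\<lambda>x. f x + g x) \<in> sums_of_smooth_products"

lemma smooth_mult:
  assumes "smooth f" "smooth g"
  shows "smooth (\<lambda>x. f x * g x)"
proof (rule smooth_coinduct[where S = sums_of_smooth_products])
  fix h assume "h \<in> sums_of_smooth_products"
  then show "\<exists>h'\<in>sums_of_smooth_products. \<forall>x. (h has_real_derivative h' x) (at x)"
  proof induction
    case (1 f g)
    have "((\<lambda>x. f x * g x) has_real_derivative deriv f x * g x + f x * deriv g x) (at x)" for x
      using DERIV_mult[OF smooth_has_real_derivative[OF 1(1)] smooth_has_real_derivative[OF 1(2)], of x] by (simp add: algebra_simps)
    moreover have "(\<lambda>x. deriv f x * g x + f x * deriv g x) \<in> sums_of_smooth_products"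
      by (intro sums_of_smooth_products.intros smooth_deriv 1)
    ultimately show ?case
      by (intro bexI[where x = "\<lambda>x. deriv f x * g x + f x * deriv g x"] allI)
  next
    case (2 f g)
    then obtain f' g' where "f' \<in> sums_of_smooth_products" "g' \<in> sums_of_smooth_products"
      and "\<And>x. (f has_real_derivative f' x) (at x)" "\<And>x. (g has_real_derivative g' x) (at x)"
      by blast
    then show ?case
      by (intro bexI[where x = "\<lambda>x. f' x + g' x"] allI DERIV_add sums_of_smooth_products.intros)
  qed
qed (intro sums_of_smooth_products.intros assms)

text \<open>For \<open>p = 1\<close> this is the classical exp(-1/x), extended by 0. The polynomial
  in \<open>1 / x\<close> makes the family closed under differentiation.\<close>

definition poly_exp_inverse :: "real poly \<Rightarrow> real \<Rightarrow> real" where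
  "poly_exp_inverse p x = (if x > 0 then poly p (1 / x) * exp (- (1 / x)) else 0)"

lemma poly_times_exp_minus_tendsto_0:
  "((\<lambda>t::real. poly p t * exp (- t)) \<longlongrightarrow> 0) at_top"
proof -
  have "((\<lambda>t. \<Sum>i\<le>degree p. coeff p i * (t ^ i / exp t)) \<longlongrightarrow> (\<Sum>i\<le>degree p. coeff p i * 0)) at_top"
    by (intro tendsto_sum tendsto_mult_left tendsto_power_div_exp_0)
  moreover have "(\<Sum>i\<le>degree p. coeff p i * (t ^ i / exp t)) = poly p t * exp (- t)" for t
    by (simp add: poly_altdef sum_distrib_right exp_minus divide_inverse mult.assoc)
  ultimately show ?thesis by simp
qed

text \<open>With t = 1/x, so that dt/dx = -t^2, the derivative of p(t) exp(-t) is t^2 (p - p')(t)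
  exp(-t). At 0 the right difference quotient is t p(t) exp(-t), which tends to 0 as t
  grows.\<close>

lemma poly_exp_inverse_has_derivative:
  "(poly_exp_inverse p has_real_derivative
     poly_exp_inverse ([:0, 0, 1:] * (p - pderiv p)) x) (at x)"
proof -
  consider "x > 0" | "x < 0" | "x = 0" by linarith
  then show ?thesis
  proof cases
    case 1
    have "((\<lambda>x. poly p (1 / x) * exp (- (1 / x))) has_real_derivative
            poly_exp_inverse ([:0, 0, 1:] * (p - pderiv p)) x) (at x)"
      using 1 by (auto intro!: derivative_eq_intros DERIV_chain2[OF poly_DERIV]
          simp: poly_exp_inverse_def field_simps power2_eq_square)
    then show ?thesis
      by (rule has_field_derivative_transform_within_open[where S = "{0<..}"])
        (use 1 in \<open>auto simp: poly_exp_inverse_def\<close>)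
  next
    case 2
    have "((\<lambda>x. 0) has_real_derivative
            poly_exp_inverse ([:0, 0, 1:] * (p - pderiv p)) x) (at x)"
      using 2 by (simp add: poly_exp_inverse_def)
    then show ?thesis
      by (rule has_field_derivative_transform_within_open[where S = "{..<0}"])
        (use 2 in \<open>auto simp: poly_exp_inverse_def\<close>)
  next
    case 3
    have "((\<lambda>y. poly_exp_inverse p y / y) \<longlongrightarrow> 0) (at_right 0)"
    proof -
      \<comment> \<open>\<open>pCons 0 p\<close> is the polynomial t p(t); its extra factor absorbs
        the division by \<open>y\<close>.\<close>
      have "((\<lambda>y::real. poly (pCons 0 p) (inverse y) * exp (- inverse y)) \<longlongrightarrow> 0) (at_right 0)"
        using filterlim_compose[OF poly_times_exp_minus_tendsto_0 filterlim_inverse_at_top_right] .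
      then show ?thesis
        by (rule Lim_transform_eventually)
          (auto simp: eventually_at_filter poly_exp_inverse_def field_simps)
    qed
    moreover have "((\<lambda>y. poly_exp_inverse p y / y) \<longlongrightarrow> 0) (at_left 0)"
      by (rule Lim_transform_eventually[of "\<lambda>_. 0"])
        (auto simp: eventually_at_filter poly_exp_inverse_def)
    ultimately have "((\<lambda>y. poly_exp_inverse p y / y) \<longlongrightarrow> 0) (at 0)"
      by (simp add: filterlim_split_at)
    then show ?thesis
      by (simp add: 3 has_field_derivative_iff poly_exp_inverse_def)
  qed
qed

lemma smooth_poly_exp_inverse: "smooth (poly_exp_inverse p)"
proof (rule smooth_coinduct[where S = "range poly_exp_inverse"])
  fix g assume "g \<in> range poly_exp_inverse"
  then obtain q where "g = poly_exp_inverse q" by blast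
  then show "\<exists>g'\<in>range poly_exp_inverse. \<forall>x. (g has_real_derivative g' x) (at x)"
    using poly_exp_inverse_has_derivative[of q] by blast
qed simp

text \<open>Growing \<open>n\<close> steepens the two edges without enlarging the support: the
  values stay in [0,1], vanish outside the fixed interval (c,d), and tend to 1 inside it.\<close>

definition cutoff :: "nat \<Rightarrow> real \<Rightarrow> real \<Rightarrow> real \<Rightarrow> real" where
  "cutoff n c d x =
     poly_exp_inverse 1 (real n * (x - c)) * poly_exp_inverse 1 (real n * (d - x))"

lemma smooth_cutoff: "smooth (cutoff n c d)"
proof -
  have "smooth (\<lambda>x. poly_exp_inverse 1 (real n * x + real n * (- c)) *
                    poly_exp_inverse 1 ((- real n) * x + real n * d))"
    by (intro smooth_mult smooth_affine smooth_poly_exp_inverse)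
  then show ?thesis
    by (simp add: cutoff_def[abs_def] algebra_simps)
qed

lemma cutoff_nonneg: "0 \<le> cutoff n c d x"
  and cutoff_le_1: "cutoff n c d x \<le> 1"
  by (auto simp: cutoff_def poly_exp_inverse_def intro!: mult_le_one)

lemma cutoff_eq_0: "x \<notin> {c<..<d} \<Longrightarrow> cutoff n c d x = 0"
  by (auto simp: cutoff_def poly_exp_inverse_def zero_less_mult_iff)

lemma cutoff_shift: "cutoff n c d (x - t) = cutoff n (c + t) (d + t) x"
  by (simp add: cutoff_def algebra_simps)

lemma cutoff_tendsto_indicator:
  "(\<lambda>n. cutoff n c d x) \<longlonglongrightarrow> indicator {c<..<d} x"
proof (cases "x \<in> {c<..<d}")
  case True
  have "(\<lambda>n. poly_exp_inverse 1 (real n * y)) \<longlonglongrightarrow> 1" if "y > 0" for y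
  proof -
    have "filterlim (\<lambda>n. real n * y) at_top sequentially"
      using filterlim_tendsto_pos_mult_at_top[OF tendsto_const that filterlim_real_sequentially]
      by (simp add: mult.commute)
    then have "(\<lambda>n. exp (- inverse (real n * y))) \<longlonglongrightarrow> exp (- 0)"
      by (intro tendsto_intros tendsto_inverse_0_at_top)
    \<comment> \<open>At \<open>n = 0\<close> the argument is 0 and the value is 0, so the agreement
      with the exponential starts at \<open>n > 0\<close>.\<close>
    then show ?thesis
      using that
      by (auto elim!: Lim_transform_eventually
          intro!: eventually_mono[OF eventually_gt_at_top[of 0]]
          simp: poly_exp_inverse_def inverse_eq_divide)
  qed
  from tendsto_mult[OF this this, of "x - c" "d - x"] True show ?thesis
    by (simp add: cutoff_def)
qed (simp add: cutoff_eq_0)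

lemma borel_measurable_cutoff [measurable]: "cutoff n c d \<in> borel_measurable borel"
  by (intro borel_measurable_continuous_onI smooth_continuous_on smooth_cutoff)

section \<open>Test functions with support inside the unit interval\<close>

lemma test_functionsI:
  assumes "smooth f" "0 < c" "d < 1" "\<And>x. x \<notin> {c..d} \<Longrightarrow> f x = 0"
  shows "f \<in> test_functions"
  using assms unfolding test_functions_def smooth_def by blast

lemma deriv_test_function:
  assumes "\<phi> \<in> test_functions"
  shows "deriv \<phi> \<in> test_functions"
proof -
  from assms obtain c d where cd: "0 < c" "d < 1" "\<And>x. x \<notin> {c..d} \<Longrightarrow> \<phi> x = 0"
    and "smooth \<phi>"
    unfolding test_functions_def smooth_def by blast
  have "deriv \<phi> x = 0" if "x \<notin> {c..d}" for x
  proof -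
    have "(\<phi> has_real_derivative 0) (at x)"
      by (rule has_field_derivative_transform_within_open[where S = "- {c..d}" and f = "\<lambda>_. 0"])
        (use that cd in auto)
    then show ?thesis by (rule DERIV_imp_deriv)
  qed
  with cd \<open>smooth \<phi>\<close> show ?thesis
    by (intro test_functionsI[of _ c d] smooth_deriv)
qed

lemma cutoff_test_function: "0 < c \<Longrightarrow> d < 1 \<Longrightarrow> cutoff n c d \<in> test_functions"
  by (rule test_functionsI[OF smooth_cutoff]) (auto simp: cutoff_eq_0)

subsection \<open>Fundamental lemmas of the calculus of variations\<close>

lemma emeasure_leb01_space: "emeasure leb01 (space leb01) = 1"
  by (simp add: emeasure_restrict_space)

interpretation leb01: finite_measure leb01
  by standard (simp only: emeasure_leb01_space infinity_ennreal_def ennreal_one_neq_top not_False_eq_True)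

lemma measure_leb01_space: "measure leb01 {0<..<1} = 1"
  by (simp add: measure_restrict_space)

lemma borel_measurable_leb01:
  assumes "g \<in> borel_measurable borel"
  shows "g \<in> borel_measurable leb01"
  using assms by (intro measurable_restrict_space1 measurable_completion) simp

lemma integrable_leb01_mult_bounded:
  fixes u g :: "real \<Rightarrow> real"
  assumes "integrable leb01 u" "g \<in> borel_measurable borel" "\<And>x. \<bar>g x\<bar> \<le> 1"
  shows "integrable leb01 (\<lambda>x. u x * g x)"
proof (rule Bochner_Integration.integrable_bound[OF assms(1)])
  show "(\<lambda>x. u x * g x) \<in> borel_measurable leb01"
    by (intro borel_measurable_times[OF borel_measurable_integrable[OF assms(1)] borel_measurable_leb01] assms)
  show "AE x in leb01. norm (u x * g x) \<le> norm (u x)"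
    using assms(3) by (auto simp: abs_mult mult_left_le)
qed

text \<open>Dominated convergence with majorant |u|. It carries the passages from smooth or averaged
  weights to indicators of intervals.\<close>

lemma leb01_bounded_convergence:
  fixes u l :: "real \<Rightarrow> real" and g :: "nat \<Rightarrow> real \<Rightarrow> real"
  assumes "integrable leb01 u" "\<And>n. g n \<in> borel_measurable borel"
    and "\<And>n x. \<bar>g n x\<bar> \<le> 1" "\<And>x. (\<lambda>n. g n x) \<longlonglongrightarrow> l x"
  shows "(\<lambda>n. \<integral>x. u x * g n x \<partial>leb01) \<longlonglongrightarrow> (\<integral>x. u x * l x \<partial>leb01)"
proof (rule integral_dominated_convergence[where w = "\<lambda>x. \<bar>u x\<bar>"])
  have "l \<in> borel_measurable borel"
    by (rule borel_measurable_LIMSEQ_real[OF assms(4,2)])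
  then show "(\<lambda>x. u x * l x) \<in> borel_measurable leb01"
    by (intro borel_measurable_times[OF borel_measurable_integrable[OF assms(1)] borel_measurable_leb01])
  show "(\<lambda>x. u x * g n x) \<in> borel_measurable leb01" for n
    by (intro borel_measurable_times[OF borel_measurable_integrable[OF assms(1)] borel_measurable_leb01] assms)
  show "AE x in leb01. norm (u x * g n x) \<le> \<bar>u x\<bar>" for n
    using assms(3) by (auto simp: abs_mult mult_left_le)
  show "AE x in leb01. (\<lambda>n. u x * g n x) \<longlonglongrightarrow> u x * l x"
    using assms(4) by (intro AE_I2 tendsto_mult_left)
  show "integrable leb01 (\<lambda>x. \<bar>u x\<bar>)"
    using assms(1) by simp
qed

text \<open>Weaker than a classical Lebesgue point: only signed averages to the right of
  \<open>x\<close> must converge, and they must converge to the value of the given representative at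
  \<open>x\<close>.\<close>

definition right_Lebesgue_point :: "(real \<Rightarrow> real) \<Rightarrow> real \<Rightarrow> bool" where
  "right_Lebesgue_point u x \<longleftrightarrow>
     ((\<lambda>h. (\<integral>y. u y * indicator {x<..<x + h} y \<partial>leb01) / h) \<longlongrightarrow> u x) (at_right 0)"

text \<open>Lebesgue's differentiation theorem for cubes with lower corner \<open>x\<close>, which
  in dimension one are the intervals to the right of \<open>x\<close>.\<close>

lemma AE_right_Lebesgue_point:
  assumes u: "integrable leb01 u"
  shows "AE x in leb01. right_Lebesgue_point u x"
proof -
  \<comment> \<open>Extension by 0 makes the function integrable on every box of the line, as
    \<open>integrable_ccontinuous_explicit\<close> asks.\<close>
  define U where "U = (\<lambda>x. indicator {0<..<1} x * u x)"
  have U: "integrable lebesgue U"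
    using u by (simp add: integrable_restrict_space U_def)
  have "U integrable_on cbox c d" for c d
    using integrable_on_lebesgue[OF U] integrable_on_subcbox by blast
  then obtain N where N: "negligible N"
    "\<And>x e. \<lbrakk>x \<notin> N; 0 < e\<rbrakk> \<Longrightarrow> \<exists>d>0. \<forall>h. 0 < h \<and> h < d \<longrightarrow>
        norm (integral (cbox x (x + h *\<^sub>R One)) U /\<^sub>R h ^ DIM(real) - U x) < e"
    using integrable_ccontinuous_explicit[of U] by metis
  have box: "integral {x..x + h} U = (\<integral>y. u y * indicator {x<..<x + h} y \<partial>leb01)" for x h
  proof -
    have "set_integrable lebesgue {x<..<x + h} U"
      unfolding set_integrable_def using U by (intro integrable_mult_indicator) auto
    then have "integral {x<..<x + h} U = (LINT y:{x<..<x + h}|lebesgue. U y)"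
      by (simp add: set_lebesgue_integral_eq_integral)
    also have "\<dots> = (\<integral>y. u y * indicator {x<..<x + h} y \<partial>leb01)"
      by (simp add: set_lebesgue_integral_def integral_restrict_space U_def mult_ac)
    finally show ?thesis by (simp add: integral_open_interval_real)
  qed
  have "right_Lebesgue_point u x" if "x \<notin> N" "x \<in> {0<..<1}" for x
    unfolding right_Lebesgue_point_def
  proof (rule tendstoI)
    have [simp]: "U x = u x" using that(2) by (simp add: U_def)
    fix e :: real assume "e > 0"
    from N(2)[OF that(1) this] obtain d where "d > 0"
      "\<And>h. 0 < h \<Longrightarrow> h < d \<Longrightarrow> norm (integral {x..x + h} U / h - U x) < e"
      by (auto simp: divide_inverse mult.commute)
    then show "\<forall>\<^sub>F h in at_right 0.
        dist ((\<integral>y. u y * indicator {x<..<x + h} y \<partial>leb01) / h) (u x) < e"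
      unfolding eventually_at_right_field
      by (intro exI[of _ d]) (simp add: dist_norm flip: box)
  qed
  moreover have "AE x in lebesgue. x \<notin> N"
    using N(1) by (simp add: AE_not_in negligible_iff_null_sets)
  ultimately show ?thesis
    by (subst AE_restrict_space_iff) auto
qed

text \<open>In the limit the integral of \<open>f\<close> over every interval compactly inside (0,1)
  is 0, so at a right Lebesgue point \<open>f\<close> is a limit of averages that are eventually
  0.\<close>

lemma AE_eq_0_of_cutoff_integrals:
  assumes f: "integrable leb01 f"
    and 0: "\<And>n c d. 0 < c \<Longrightarrow> d < 1 \<Longrightarrow> (\<integral>x. f x * cutoff n c d x \<partial>leb01) = 0"
  shows "AE x in leb01. f x = 0"
proof -
  have int0: "(\<integral>x. f x * indicator {c<..<d} x \<partial>leb01) = 0" if "0 < c" "d < 1" for c d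
  proof (rule LIMSEQ_unique)
    show "(\<lambda>n. \<integral>x. f x * cutoff n c d x \<partial>leb01) \<longlonglongrightarrow> (\<integral>x. f x * indicator {c<..<d} x \<partial>leb01)"
      by (intro leb01_bounded_convergence f cutoff_tendsto_indicator)
        (auto simp: cutoff_nonneg cutoff_le_1)
  qed (simp add: 0 that)
  have point: "f x = 0" if "right_Lebesgue_point f x" "x \<in> {0<..<1}" for x
  proof (rule tendsto_unique)
    show "((\<lambda>h. (\<integral>y. f y * indicator {x<..<x + h} y \<partial>leb01) / h) \<longlongrightarrow> f x) (at_right 0)"
      using that(1) by (simp add: right_Lebesgue_point_def)
    have "\<forall>\<^sub>F h in at_right 0. (\<integral>y. f y * indicator {x<..<x + h} y \<partial>leb01) / h = 0"
      unfolding eventually_at_right_field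
      using that(2) by (intro exI[of _ "1 - x"]) (auto simp: int0)
    then show "((\<lambda>h. (\<integral>y. f y * indicator {x<..<x + h} y \<partial>leb01) / h) \<longlongrightarrow> 0) (at_right 0)"
      by (rule tendsto_eventually)
  qed simp
  show ?thesis
    using AE_right_Lebesgue_point[OF f] AE_space[of leb01]
    by eventually_elim (simp add: point)
qed

text \<open>The test function is a cutoff of (c, c + h) integrated over the sliding window
  [x - t, x]. Its derivative is the cutoff minus its translate by \<open>t\<close>; these have equal
  mass, so the support is compact. As the cutoffs tend to indicators, the test function tends to the
  trapezoid \<open>T\<close>.\<close>

lemma weak_antiderivative_increment_averages:
  assumes u: "integrable leb01 u" and v: "integrable leb01 v"
    and weak: "\<And>\<phi>. \<phi> \<in> test_functions \<Longrightarrow>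
      (\<integral>x. u x * deriv \<phi> x \<partial>leb01) = - (\<integral>x. v x * \<phi> x \<partial>leb01)"
    and c: "0 < c" "0 < t" "0 < h" "c + t + h < 1"
  defines "T \<equiv> \<lambda>x. measure lborel ({x - t..x} \<inter> {c<..<c + h})"
  shows "(\<integral>x. u x * indicator {c + t<..<c + t + h} x \<partial>leb01) -
         (\<integral>x. u x * indicator {c<..<c + h} x \<partial>leb01) = (\<integral>x. v x * T x \<partial>leb01)"
    and "T \<in> borel_measurable borel"
proof -
  define \<phi> where
    "\<phi> = (\<lambda>n x. \<integral>y. indicator {x - t..x} y * cutoff n c (c + h) y \<partial>lborel)"
  have \<phi>: "smooth (\<phi> n)"
    "deriv (\<phi> n) x = cutoff n c (c + h) x - cutoff n (c + t) (c + t + h) x" for n x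
  proof -
    have "\<exists>F. \<forall>x. - \<infinity> < ereal x \<longrightarrow> ereal x < \<infinity> \<longrightarrow>
            (F has_vector_derivative cutoff n c (c + h) x) (at x)"
      by (rule einterval_antiderivative)
        (auto intro!: continuous_on_interior[OF smooth_continuous_on[OF smooth_cutoff, of UNIV]])
    then obtain F where F: "\<And>x. (F has_real_derivative cutoff n c (c + h) x) (at x)"
      by (auto simp: has_real_derivative_iff_has_vector_derivative)
    \<comment> \<open>The argument is written \<open>1 * x + (- t)\<close> to fit the affine form in
      \<open>smooth_affine\<close>.\<close>
    have eq: "\<phi> n = (\<lambda>x. F x - F (1 * x + (- t)))"
    proof
      fix x
      have "\<phi> n x = F x - F (x - t)"
        using integral_FTC_atLeastAtMost[of "x - t" x F "cutoff n c (c + h)"] c F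
        unfolding \<phi>_def
        by (auto simp: smooth_continuous_on smooth_cutoff has_field_derivative_at_within
            simp flip: has_real_derivative_iff_has_vector_derivative)
      then show "\<phi> n x = F x - F (1 * x + (- t))" by simp
    qed
    show "smooth (\<phi> n)"
      unfolding eq by (intro smooth_diff smooth_affine smooth_antideriv[OF smooth_cutoff F])
    have "(\<phi> n has_real_derivative cutoff n c (c + h) x - cutoff n c (c + h) (x - t)) (at x)"
      unfolding eq by (auto intro!: derivative_eq_intros DERIV_chain2[OF F] F)
    then show "deriv (\<phi> n) x = cutoff n c (c + h) x - cutoff n (c + t) (c + t + h) x"
      by (simp add: DERIV_imp_deriv cutoff_shift add_ac)
  qed
  have \<phi>_le: "\<phi> n x \<le> 1" and \<phi>_ge: "0 \<le> \<phi> n x" for n x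
  proof -
    show "0 \<le> \<phi> n x"
      unfolding \<phi>_def by (intro integral_nonneg_AE AE_I2 mult_nonneg_nonneg cutoff_nonneg) simp
    have "\<phi> n x \<le> (\<integral>y. indicator {c<..<c + h} y \<partial>lborel)"
      unfolding \<phi>_def
    proof (rule integral_mono')
      show "indicator {x - t..x} y * cutoff n c (c + h) y \<le> indicator {c<..<c + h} y" for y
        using cutoff_le_1[of n c "c + h" y] cutoff_eq_0[of y c "c + h" n]
        by (auto simp: indicator_def)
    qed (use c in \<open>auto simp: cutoff_nonneg\<close>)
    \<comment> \<open>The integral of the indicator is \<open>h\<close>, and \<open>h < 1\<close>
      follows from \<open>c + t + h < 1\<close>.\<close>
    then show "\<phi> n x \<le> 1" using c by simp
  qed
  have "\<phi> n x = 0" if "x \<notin> {c..c + t + h}" for n x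
  proof -
    have "(\<lambda>y. indicator {x - t..x} y * cutoff n c (c + h) y) = (\<lambda>_. 0)"
      using that by (auto simp: indicator_def fun_eq_iff intro!: cutoff_eq_0)
    then show ?thesis by (simp add: \<phi>_def)
  qed
  then have test: "\<phi> n \<in> test_functions" for n
    using c by (intro test_functionsI[of _ c "c + t + h"] \<phi>) auto
  have \<phi>_lim: "(\<lambda>n. \<phi> n x) \<longlonglongrightarrow> T x" for x
  proof -
    have "(\<lambda>n. \<phi> n x) \<longlonglongrightarrow> (\<integral>y. indicator {x - t..x} y * indicator {c<..<c + h} y \<partial>lborel)"
      unfolding \<phi>_def
    proof (rule integral_dominated_convergence[where w = "indicator {x - t..x}"])
      show "AE y in lborel. (\<lambda>n. indicator {x - t..x} y * cutoff n c (c + h) y) \<longlonglongrightarrow>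
              indicator {x - t..x} y * indicator {c<..<c + h} y"
        by (intro AE_I2 tendsto_mult_left cutoff_tendsto_indicator)
      show "AE y in lborel. norm (indicator {x - t..x} y * cutoff n c (c + h) y) \<le>
              indicator {x - t..x} y" for n
        using cutoff_nonneg cutoff_le_1 by (auto simp: indicator_def)
    qed (use c in auto)
    moreover have "(\<integral>y. indicator {x - t..x} y * indicator {c<..<c + h} y \<partial>lborel) = T x"
      by (simp add: T_def flip: indicator_inter_arith)
    ultimately show ?thesis by simp
  qed
  have \<phi>_meas: "\<phi> n \<in> borel_measurable borel" for n
    by (intro borel_measurable_continuous_onI smooth_continuous_on \<phi>)
  show "T \<in> borel_measurable borel"
    by (rule borel_measurable_LIMSEQ_real[OF \<phi>_lim \<phi>_meas])
  have "(\<integral>x. u x * cutoff n c (c + h) x \<partial>leb01) - (\<integral>x. u x * cutoff n (c + t) (c + t + h) x \<partial>leb01)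
      = - (\<integral>x. v x * \<phi> n x \<partial>leb01)" for n
  proof -
    have int: "integrable leb01 (\<lambda>x. u x * cutoff n p q x)" for p q
      by (intro integrable_leb01_mult_bounded u) (auto simp: cutoff_nonneg cutoff_le_1)
    show ?thesis
      unfolding weak[OF test, symmetric] \<phi>(2) right_diff_distrib
      by (intro Bochner_Integration.integral_diff[symmetric] int)
  qed
  moreover have "(\<lambda>n. (\<integral>x. u x * cutoff n c (c + h) x \<partial>leb01) -
        (\<integral>x. u x * cutoff n (c + t) (c + t + h) x \<partial>leb01)) \<longlonglongrightarrow>
      (\<integral>x. u x * indicator {c<..<c + h} x \<partial>leb01) -
      (\<integral>x. u x * indicator {c + t<..<c + t + h} x \<partial>leb01)"
    by (intro tendsto_diff leb01_bounded_convergence u cutoff_tendsto_indicator)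
      (auto simp: cutoff_nonneg cutoff_le_1)
  moreover have "(\<lambda>n. - (\<integral>x. v x * \<phi> n x \<partial>leb01)) \<longlonglongrightarrow> - (\<integral>x. v x * T x \<partial>leb01)"
    by (intro tendsto_minus leb01_bounded_convergence v \<phi>_lim \<phi>_meas)
      (simp add: \<phi>_ge \<phi>_le)
  ultimately show "(\<integral>x. u x * indicator {c + t<..<c + t + h} x \<partial>leb01) -
         (\<integral>x. u x * indicator {c<..<c + h} x \<partial>leb01) = (\<integral>x. v x * T x \<partial>leb01)"
    using LIMSEQ_unique by fastforce
qed

text \<open>Take \<open>t = d - c\<close> in the identity for averages, divide by \<open>h\<close>
  and let \<open>h\<close> tend to 0: the averages converge to \<open>u d\<close> and
  \<open>u c\<close>, and the trapezoid divided by \<open>h\<close> to an indicator.\<close>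

lemma weak_antiderivative_increment:
  assumes u: "integrable leb01 u" and v: "integrable leb01 v"
    and weak: "\<And>\<phi>. \<phi> \<in> test_functions \<Longrightarrow>
      (\<integral>x. u x * deriv \<phi> x \<partial>leb01) = - (\<integral>x. v x * \<phi> x \<partial>leb01)"
    and "0 < c" "c < d" "d < 1" "right_Lebesgue_point u c" "right_Lebesgue_point u d"
  shows "u d - u c = (\<integral>x. v x * indicator {c<..d} x \<partial>leb01)"
proof -
  \<comment> \<open>A positive null sequence bounded by (1 - d)/2, so that the right-hand window (d,
    d + h) stays inside the unit interval.\<close>
  define h where "h = (\<lambda>k. (1 - d) / 2 / real (Suc k))"
  define T where "T = (\<lambda>k x. measure lborel ({x - (d - c)..x} \<inter> {c<..<c + h k}))"
  have h: "h k > 0" "d + h k < 1" for k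
  proof -
    show "h k > 0" using assms by (simp add: h_def)
    have "h k \<le> (1 - d) / 2" using assms divide_left_mono[of 1 "real (Suc k)" "(1 - d) / 2"] by (simp add: h_def)
    then show "d + h k < 1" using assms by simp
  qed
  have h_lim: "h \<longlonglongrightarrow> 0"
    unfolding h_def by (rule real_tendsto_divide_at_top[OF tendsto_const])
      (rule filterlim_compose[OF filterlim_real_sequentially filterlim_Suc])
  then have h_right: "filterlim h (at_right 0) sequentially"
    using h(1) by (auto simp: filterlim_at less_imp_neq[THEN not_sym])
  have incr: "(\<integral>x. u x * indicator {d<..<d + h k} x \<partial>leb01) -
         (\<integral>x. u x * indicator {c<..<c + h k} x \<partial>leb01) = (\<integral>x. v x * T k x \<partial>leb01)"
    and T_meas: "T k \<in> borel_measurable borel" for k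
    using weak_antiderivative_increment_averages[OF u v weak, of c "d - c" "h k"] assms h
    by (auto simp: T_def)
  have T_le: "\<bar>T k x / h k\<bar> \<le> 1" for k x
  proof -
    have "T k x \<le> measure lborel {c<..<c + h k}"
      unfolding T_def by (intro measure_mono_fmeasurable)
        (use h(1)[of k] in \<open>auto simp: fmeasurable_def\<close>)
    then show ?thesis using h[of k] by (simp add: T_def)
  qed
  \<comment> \<open>The half-open interval gives the limit at every point: the window
    [x - (d - c), x] misses (c, c + h) at \<open>x = c\<close>, but at \<open>x = d\<close> it
    contains it once \<open>h\<close> is small.\<close>
  have T_lim: "(\<lambda>k. T k x / h k) \<longlonglongrightarrow> indicator {c<..d} x" for x
  proof -
    have "\<forall>\<^sub>F k in sequentially. T k x / h k = indicator {c<..d} x"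
    proof (cases "x \<le> c")
      case True
      then have "{x - (d - c)..x} \<inter> {c<..<c + h k} = {}" for k
        by auto
      then have "T k x = 0" for k
        by (simp add: T_def)
      with True show ?thesis by simp
    next
      case False
      show ?thesis
      proof (cases "x \<le> d")
        case True
        have "\<forall>\<^sub>F k in sequentially. h k < x - c"
          using h_lim False by (intro order_tendstoD) auto
        then show ?thesis
        proof eventually_elim
          case (elim k)
          then have "{x - (d - c)..x} \<inter> {c<..<c + h k} = {c<..<c + h k}"
            using True by auto
          with h[of k] True False show ?case by (simp add: T_def)
        qed
      next
        case False
        have "\<forall>\<^sub>F k in sequentially. h k < x - d"
          using h_lim False by (intro order_tendstoD) auto
        then show ?thesis
        proof eventually_elim
          case (elim k)
          then have "{x - (d - c)..x} \<inter> {c<..<c + h k} = {}"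
            by auto
          with False show ?case by (simp add: T_def)
        qed
      qed
    qed
    then show ?thesis by (rule tendsto_eventually)
  qed
  have "(\<lambda>k. \<integral>x. v x * (T k x / h k) \<partial>leb01) \<longlonglongrightarrow> (\<integral>x. v x * indicator {c<..d} x \<partial>leb01)"
    by (intro leb01_bounded_convergence v T_le T_lim borel_measurable_divide T_meas) simp
  moreover have "(\<lambda>k. (\<integral>x. u x * indicator {d<..<d + h k} x \<partial>leb01) / h k -
         (\<integral>x. u x * indicator {c<..<c + h k} x \<partial>leb01) / h k) \<longlonglongrightarrow> u d - u c"
    using assms(7,8) unfolding right_Lebesgue_point_def
    by (intro tendsto_diff filterlim_compose[OF _ h_right])
  moreover have "(\<integral>x. v x * (T k x / h k) \<partial>leb01) =
      (\<integral>x. u x * indicator {d<..<d + h k} x \<partial>leb01) / h k -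
      (\<integral>x. u x * indicator {c<..<c + h k} x \<partial>leb01) / h k" for k
    by (simp add: incr flip: diff_divide_distrib)
  ultimately show ?thesis
    using LIMSEQ_unique by (metis (no_types, lifting) ext)
qed

subsection \<open>Bounds by the derivative of top order\<close>

text \<open>On a finite measure space 1 + u^2 is an integrable majorant of |u|.\<close>

lemma integrable_L2:
  assumes "u \<in> L2"
  shows "integrable leb01 u"
proof (rule Bochner_Integration.integrable_bound[where f = "\<lambda>x. 1 + (u x)\<^sup>2"])
  show "integrable leb01 (\<lambda>x. 1 + (u x)\<^sup>2)"
    using assms by (simp add: L2_def)
  have "\<bar>y\<bar> \<le> 1 + y\<^sup>2" for y :: real
    using zero_le_power2[of "\<bar>y\<bar> - 1"] by (simp add: power2_diff)
  then show "AE x in leb01. norm (u x) \<le> norm (1 + (u x)\<^sup>2)"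
    by (simp add: abs_of_nonneg add_nonneg_nonneg)
qed (use assms in \<open>simp add: L2_def\<close>)

text \<open>The variance of |v| is nonnegative; since the interval has measure 1, \<open>m\<close>
  is the mean of |v|.\<close>

lemma integral_abs_le_L2_norm:
  assumes "v \<in> L2"
  shows "(\<integral>x. \<bar>v x\<bar> \<partial>leb01) \<le> L2_norm v"
proof -
  define m where "m = (\<integral>x. \<bar>v x\<bar> \<partial>leb01)"
  have int: "integrable leb01 (\<lambda>x. (v x)\<^sup>2)" "integrable leb01 (\<lambda>x. 2 * m * \<bar>v x\<bar>)"
    using assms integrable_L2[OF assms] by (auto simp: L2_def)
  have "0 \<le> (\<integral>x. (\<bar>v x\<bar> - m)\<^sup>2 \<partial>leb01)"
    by simp
  also have "\<dots> = (\<integral>x. ((v x)\<^sup>2 - 2 * m * \<bar>v x\<bar>) + m\<^sup>2 \<partial>leb01)"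
    by (simp add: power2_diff algebra_simps)
  also have "\<dots> = (\<integral>x. (v x)\<^sup>2 \<partial>leb01) - 2 * m * m + m\<^sup>2"
    using int by (simp add: m_def measure_leb01_space)
  finally have "m\<^sup>2 \<le> (\<integral>x. (v x)\<^sup>2 \<partial>leb01)"
    by (simp add: power2_eq_square)
  then show ?thesis
    unfolding L2_norm_def m_def by (rule real_le_rsqrt)
qed

text \<open>Needed because \<open>weak_deriv 0 u\<close> is only some chosen function satisfying the
  order 0 identity. Cutoffs are test functions, so the difference has vanishing cutoff
  integrals.\<close>

lemma has_weak_deriv_0_AE_eq:
  assumes "has_weak_deriv 0 u v"
  shows "AE x in leb01. u x = v x"
proof -
  have int: "integrable leb01 u" "integrable leb01 v"
    using assms integrable_L2 by (auto simp: has_weak_deriv_def)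
  have "(\<integral>x. (u x - v x) * cutoff n c d x \<partial>leb01) = 0" if "0 < c" "d < 1" for n c d
  proof -
    have "integrable leb01 (\<lambda>x. w x * cutoff n c d x)" if "integrable leb01 w" for w
      by (intro integrable_leb01_mult_bounded that) (auto simp: cutoff_nonneg cutoff_le_1)
    then have "(\<integral>x. (u x - v x) * cutoff n c d x \<partial>leb01) =
        (\<integral>x. u x * cutoff n c d x \<partial>leb01) - (\<integral>x. v x * cutoff n c d x \<partial>leb01)"
      using int by (simp add: left_diff_distrib)
    also have "\<dots> = 0"
      using assms cutoff_test_function[OF that, of n] by (simp add: has_weak_deriv_def)
    finally show ?thesis .
  qed
  then have "AE x in leb01. u x - v x = 0"
    using int by (intro AE_eq_0_of_cutoff_integrals) auto
  then show ?thesis by simp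
qed

text \<open>Otherwise the interval (0,e) would be a null set. This supplies good points along which
  a boundary value at 0 can be reached.\<close>

lemma AE_leb01_accumulates_at_0:
  assumes "AE x in leb01. P x" "0 < e" "e < 1"
  shows "\<exists>x. 0 < x \<and> x < e \<and> P x"
proof (rule ccontr)
  assume contra: "\<nexists>x. 0 < x \<and> x < e \<and> P x"
  from assms(1) have "AE x in leb01. x \<notin> {0<..<e}"
    by eventually_elim (use contra in auto)
  then have "AE x in lebesgue. x \<notin> {0<..<e}"
    by (subst (asm) AE_restrict_space_iff) (use assms in \<open>auto elim!: eventually_mono\<close>)
  then have "{0<..<e} \<in> null_sets lebesgue"
    by (subst AE_iff_null_sets) auto
  then have "emeasure lborel {0<..<e} = 0"
    by (simp add: null_sets_def)
  then show False
    using assms(2) by simp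
qed

text \<open>Apply the increment formula between \<open>s k\<close> and \<open>x\<close>, where the
  \<open>s k\<close> are good points tending to 0. There \<open>u\<close> agrees with its continuous
  representative \<open>w\<close>, hence \<open>u (s k)\<close> tends to
  \<open>w 0 = 0\<close>.\<close>

lemma weak_antiderivative_AE_eq_integral:
  assumes weak: "has_weak_deriv 1 u v" and value_0: "has_value_at u 0 0"
  shows "AE x in leb01. u x = (\<integral>y. v y * indicator {0<..x} y \<partial>leb01)"
proof -
  have u: "integrable leb01 u" and v: "integrable leb01 v"
    using weak integrable_L2 by (auto simp: has_weak_deriv_def)
  obtain w where w: "continuous_on {0..1} w" "AE x in leb01. u x = w x" "w 0 = 0"
    using value_0 unfolding has_value_at_def by blast
  define P where "P = (\<lambda>x. x \<in> {0<..<1} \<and> right_Lebesgue_point u x \<and> u x = w x)"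
  have AE_P: "AE x in leb01. P x"
    using AE_right_Lebesgue_point[OF u] AE_space[of leb01] w(2)
    by eventually_elim (simp add: P_def)
  \<comment> \<open>The shift by 2 keeps the bound strictly below 1 even for
    \<open>k = 0\<close>.\<close>
  have "\<exists>x. 0 < x \<and> x < 1 / real (k + 2) \<and> P x" for k
    by (rule AE_leb01_accumulates_at_0[OF AE_P]) auto
  then obtain s where s: "\<And>k. 0 < s k" "\<And>k. s k < 1 / real (k + 2)" "\<And>k. P (s k)"
    by metis
  have s_lim: "s \<longlonglongrightarrow> 0"
  proof (rule tendsto_sandwich[OF _ _ tendsto_const])
    show "(\<lambda>k. 1 / real (k + 2)) \<longlonglongrightarrow> 0"
      by (rule LIMSEQ_ignore_initial_segment[OF lim_1_over_n])
  qed (use s in \<open>auto intro!: always_eventually less_imp_le\<close>)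
  have "(\<lambda>k. w (s k)) \<longlonglongrightarrow> w 0"
    using s(3) by (intro continuous_on_tendsto_compose[OF w(1) s_lim] always_eventually)
      (auto simp: P_def less_imp_le)
  then have us_lim: "(\<lambda>k. u (s k)) \<longlonglongrightarrow> 0"
    using s(3) w(3) by (simp add: P_def)
  have "u x = (\<integral>y. v y * indicator {0<..x} y \<partial>leb01)" if x: "P x" for x
  proof (rule LIMSEQ_unique)
    show "(\<lambda>k. u x - u (s k)) \<longlonglongrightarrow> u x"
      using tendsto_diff[OF tendsto_const us_lim, of "u x"] by simp
    have "(\<lambda>k. \<integral>y. v y * indicator {s k<..x} y \<partial>leb01) \<longlonglongrightarrow>
            (\<integral>y. v y * indicator {0<..x} y \<partial>leb01)"
    proof (rule leb01_bounded_convergence[OF v])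
      show "(\<lambda>k. indicator {s k<..x} y :: real) \<longlonglongrightarrow> indicator {0<..x} y" for y
      proof (cases "y > 0")
        case True
        then have "\<forall>\<^sub>F k in sequentially. s k < y"
          using s_lim by (intro order_tendstoD)
        then have "\<forall>\<^sub>F k in sequentially. indicator {s k<..x} y = (indicator {0<..x} y :: real)"
          by eventually_elim (use True in \<open>auto simp: indicator_def\<close>)
        then show ?thesis by (rule tendsto_eventually)
      next
        case False
        then have "\<not> s k < y" for k
          using s(1)[of k] by simp
        with False show ?thesis by simp
      qed
    qed (auto simp: indicator_def)
    moreover have "\<forall>\<^sub>F k in sequentially.
        (\<integral>y. v y * indicator {s k<..x} y \<partial>leb01) = u x - u (s k)"
    proof -
      have "\<forall>\<^sub>F k in sequentially. s k < x"
        using s_lim x by (intro order_tendstoD) (auto simp: P_def)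
      then show ?thesis
      proof eventually_elim
        case (elim k)
        show ?case
          by (rule weak_antiderivative_increment[OF u v, symmetric])
            (use weak elim x s(3)[of k] in \<open>auto simp: has_weak_deriv_def P_def\<close>)
      qed
    qed
    ultimately show "(\<lambda>k. u x - u (s k)) \<longlonglongrightarrow> (\<integral>y. v y * indicator {0<..x} y \<partial>leb01)"
      by (rule Lim_transform_eventually)
  qed
  with AE_P show ?thesis
    by (rule eventually_mono)
qed

text \<open>A Poincare inequality in the sup norm; the constant is 1 because the interval has length
  1.\<close>

lemma AE_abs_le_L2_norm_weak_deriv:
  assumes "has_weak_deriv 1 u v" and "has_value_at u 0 0"
  shows "AE x in leb01. \<bar>u x\<bar> \<le> L2_norm v"
  using weak_antiderivative_AE_eq_integral[OF assms]
proof eventually_elim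
  case (elim x)
  have v: "v \<in> L2" using assms by (simp add: has_weak_deriv_def)
  have "\<bar>u x\<bar> \<le> (\<integral>y. \<bar>v y\<bar> \<partial>leb01)"
    unfolding elim
  proof (rule order_trans[OF integral_abs_bound], rule integral_mono)
    have "integrable leb01 (\<lambda>y. v y * indicator {0<..x} y)"
      by (intro integrable_leb01_mult_bounded integrable_L2 v) (auto simp: indicator_def)
    then show "integrable leb01 (\<lambda>y. \<bar>v y * indicator {0<..x} y\<bar>)" by simp
  qed (use integrable_L2[OF v] in \<open>auto simp: indicator_def\<close>)
  then show ?case
    using integral_abs_le_L2_norm[OF v] by linarith
qed

text \<open>The pointwise majorant M^2 / a is integrable. At a zero of \<open>a\<close> both
  quotients are 0 by convention, so the comparison holds there as well.\<close>

lemma AE_bounded_weighted_L2: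
  assumes u: "u \<in> L2" and bound: "AE x in leb01. \<bar>u x\<bar> \<le> M"
    and a: "integrable leb01 (\<lambda>x. 1 / a x)" "\<And>x. x \<in> {0<..<1} \<Longrightarrow> 0 \<le> a x"
  shows "u \<in> L2w a" and "(L2w_norm a u)\<^sup>2 \<le> M\<^sup>2 * (\<integral>x. 1 / a x \<partial>leb01)"
proof -
  have le: "AE x in leb01. (u x)\<^sup>2 / a x \<le> M\<^sup>2 * (1 / a x)"
    using bound AE_space[of leb01]
  proof eventually_elim
    case (elim x)
    then have "(u x)\<^sup>2 \<le> M\<^sup>2" using abs_le_square_iff[of "u x" M] by linarith
    with elim a(2)[of x] show ?case by (simp add: divide_right_mono)
  qed
  have nonneg: "AE x in leb01. 0 \<le> (u x)\<^sup>2 / a x"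
    using a(2) by (auto intro!: AE_I2)
  have int: "integrable leb01 (\<lambda>x. (u x)\<^sup>2 / a x)"
  proof (rule Bochner_Integration.integrable_bound[where f = "\<lambda>x. M\<^sup>2 * (1 / a x)"])
    \<comment> \<open>Measurability of the weight is read off from the integrability of
      \<open>1 / a\<close>.\<close>
    have "(\<lambda>x. (u x)\<^sup>2 * (1 / a x)) \<in> borel_measurable leb01"
      using u a(1) by (intro borel_measurable_times borel_measurable_power
          borel_measurable_integrable[of leb01]) (auto intro: integrable_L2)
    then show "(\<lambda>x. (u x)\<^sup>2 / a x) \<in> borel_measurable leb01" by simp
    show "AE x in leb01. norm ((u x)\<^sup>2 / a x) \<le> norm (M\<^sup>2 * (1 / a x))"
      using le nonneg by eventually_elim (unfold real_norm_def, linarith)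
  qed (use a(1) in \<open>intro integrable_mult_right\<close>)
  then show "u \<in> L2w a"
    using u by (simp add: L2w_def)
  have "(L2w_norm a u)\<^sup>2 = (\<integral>x. (u x)\<^sup>2 / a x \<partial>leb01)"
    unfolding L2w_norm_def by (intro real_sqrt_pow2 integral_nonneg_AE nonneg)
  also have "\<dots> \<le> (\<integral>x. M\<^sup>2 * (1 / a x) \<partial>leb01)"
    using a(1) by (intro integral_mono_AE int le integrable_mult_right) simp
  finally show "(L2w_norm a u)\<^sup>2 \<le> M\<^sup>2 * (\<integral>x. 1 / a x \<partial>leb01)"
    by (simp only: integral_mult_right_zero)
qed

section \<open>Norm comparisons on \<open>H0\<close>\<close>

lemma L2_norm_nonneg: "0 \<le> L2_norm u"
  by (simp add: L2_norm_def)

lemma L2_norm_le_AE_bound: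
  assumes "u \<in> L2" "AE x in leb01. \<bar>u x\<bar> \<le> M" "0 \<le> M"
  shows "L2_norm u \<le> M"
proof -
  have "(L2_norm u)\<^sup>2 \<le> M\<^sup>2"
    \<comment> \<open>The constant weight 1 turns the weighted norm into \<open>L2_norm\<close>, and
      the integral of the weight is 1.\<close>
    using AE_bounded_weighted_L2(2)[OF assms(1,2), of "\<lambda>_. 1"]
    by (simp add: L2w_norm_def L2_norm_def measure_leb01_space)
  then show ?thesis
    using assms(3) by (rule power2_le_imp_le)
qed

lemma L2_norm_cong_AE:
  assumes "u \<in> L2" "v \<in> L2" "AE x in leb01. u x = v x"
  shows "L2_norm u = L2_norm v"
proof -
  have "(\<integral>x. (u x)\<^sup>2 \<partial>leb01) = (\<integral>x. (v x)\<^sup>2 \<partial>leb01)"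
    using assms by (intro integral_cong_AE) (auto simp: L2_def)
  then show ?thesis by (simp add: L2_norm_def)
qed

lemma has_value_at_cong_AE:
  assumes "AE y in leb01. f y = g y" "has_value_at g x c"
  shows "has_value_at f x c"
proof -
  obtain w where w: "continuous_on {0..1} w" "AE y in leb01. g y = w y" "w x = c"
    using assms(2) unfolding has_value_at_def by blast
  from assms(1) w(2) have "AE y in leb01. f y = w y"
    by eventually_elim simp
  with w show ?thesis unfolding has_value_at_def by blast
qed

lemma H_has_weak_deriv: "u \<in> H i \<Longrightarrow> k \<le> i \<Longrightarrow> has_weak_deriv k u (weak_deriv k u)"
  unfolding H_def weak_deriv_def using someI_ex[of "has_weak_deriv k u"] by blast

text \<open>\<open>H 2\<close> provides derivatives of \<open>u\<close> of each order separately.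
  Testing the first-order identity with the derivative of a test function shows that
  \<open>w\<close> is the weak derivative of \<open>v\<close>, so the first-order bound applies to
  \<open>v\<close> too.\<close>

lemma has_weak_deriv_2_split:
  assumes "has_weak_deriv 1 u v" "has_weak_deriv 2 u w"
  shows "has_weak_deriv 1 v w"
  unfolding has_weak_deriv_def
proof (intro conjI ballI)
  fix \<phi> assume "\<phi> \<in> test_functions"
  then show "(\<integral>x. v x * (deriv ^^ 1) \<phi> x \<partial>leb01) = (- 1) ^ 1 * (\<integral>x. w x * \<phi> x \<partial>leb01)"
    using assms deriv_test_function[of \<phi>] by (auto simp: has_weak_deriv_def numeral_2_eq_2)
qed (use assms in \<open>auto simp: has_weak_deriv_def\<close>)

lemma H0_AE_weak_deriv_0:
  assumes "u \<in> H0 i"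
  shows "AE x in leb01. u x = weak_deriv 0 u x"
  using assms H_has_weak_deriv[of u i 0] by (auto simp: H0_def intro: has_weak_deriv_0_AE_eq)

text \<open>\<open>H0\<close> states the boundary condition for \<open>weak_deriv 0 u\<close>; it
  passes to \<open>u\<close> because the two agree almost everywhere.\<close>

lemma H0_value_at_0: "u \<in> H0 i \<Longrightarrow> 0 < i \<Longrightarrow> has_value_at u 0 0"
  by (rule has_value_at_cong_AE[OF H0_AE_weak_deriv_0]) (auto simp: H0_def)

text \<open>The sup bound gives |u| <= ||u'||; for \<open>i = 2\<close> the same bound for u' gives
  ||u'|| <= ||u''||.\<close>

lemma H0_top_order_bounds:
  assumes u: "u \<in> H0 i" and i: "i \<in> {1, 2}"
  shows "AE x in leb01. \<bar>u x\<bar> \<le> L2_norm (weak_deriv i u)"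
    and "k \<le> i \<Longrightarrow> L2_norm (weak_deriv k u) \<le> L2_norm (weak_deriv i u)"
proof -
  have uH: "u \<in> H i" and uL2: "u \<in> L2"
    using u by (auto simp: H0_def H_def)
  have wd: "has_weak_deriv j u (weak_deriv j u)" if "j \<le> i" for j
    using H_has_weak_deriv[OF uH that] .
  have L2: "weak_deriv j u \<in> L2" if "j \<le> i" for j
    using wd[OF that] by (simp add: has_weak_deriv_def)
  have step1: "AE x in leb01. \<bar>u x\<bar> \<le> L2_norm (weak_deriv 1 u)"
    using i by (intro AE_abs_le_L2_norm_weak_deriv wd H0_value_at_0[OF u]) auto
  have step2: "L2_norm (weak_deriv 1 u) \<le> L2_norm (weak_deriv i u)"
  proof (cases "i = 2")
    case True
    have "has_weak_deriv 1 (weak_deriv 1 u) (weak_deriv i u)"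
      by (rule has_weak_deriv_2_split[OF wd]) (use wd[of 2] True in auto)
    moreover have "has_value_at (weak_deriv 1 u) 0 0"
      using u True by (simp add: H0_def)
    ultimately show ?thesis
      using L2[of 1] True
      by (intro L2_norm_le_AE_bound AE_abs_le_L2_norm_weak_deriv L2_norm_nonneg) auto
  qed (use i in simp)
  show bound: "AE x in leb01. \<bar>u x\<bar> \<le> L2_norm (weak_deriv i u)"
    using step1 by eventually_elim (use step2 in simp)
  have "L2_norm (weak_deriv 0 u) = L2_norm u"
    using L2[of 0] by (intro L2_norm_cong_AE[symmetric] uL2 H0_AE_weak_deriv_0[OF u]) simp
  then have step0: "L2_norm (weak_deriv 0 u) \<le> L2_norm (weak_deriv i u)"
    using L2_norm_le_AE_bound[OF uL2 bound L2_norm_nonneg] by simp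
  assume "k \<le> i"
  then consider "k = 0" | "k = 1" | "k = i"
    using i by force
  then show "L2_norm (weak_deriv k u) \<le> L2_norm (weak_deriv i u)"
    by cases (use step0 step2 in auto)
qed

lemma H0_H_norm_bounds:
  assumes u: "u \<in> H0 i" and i: "i \<in> {1, 2}"
  shows "L2_norm (weak_deriv i u) \<le> H_norm i u"
    and "H_norm i u \<le> sqrt 3 * L2_norm (weak_deriv i u)"
proof -
  have "(L2_norm (weak_deriv i u))\<^sup>2 \<le> (\<Sum>k\<le>i. (L2_norm (weak_deriv k u))\<^sup>2)"
    by (rule member_le_sum) auto
  then show "L2_norm (weak_deriv i u) \<le> H_norm i u"
    unfolding H_norm_def by (rule real_le_rsqrt)
  have "(\<Sum>k\<le>i. (L2_norm (weak_deriv k u))\<^sup>2) \<le> (\<Sum>k\<le>i. (L2_norm (weak_deriv i u))\<^sup>2)"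
    using H0_top_order_bounds(2)[OF assms] by (intro sum_mono power_mono L2_norm_nonneg) simp
  \<comment> \<open>The orders up to \<open>i\<close> number two or three, which is the source of
    the factor 3.\<close>
  also have "\<dots> \<le> 3 * (L2_norm (weak_deriv i u))\<^sup>2"
    using i by auto
  finally have "H_norm i u \<le> sqrt (3 * (L2_norm (weak_deriv i u))\<^sup>2)"
    unfolding H_norm_def by (rule real_sqrt_le_mono)
  then show "H_norm i u \<le> sqrt 3 * L2_norm (weak_deriv i u)"
    by (simp add: real_sqrt_mult L2_norm_nonneg)
qed

text \<open>The product of \<open>a\<close> with the continuous representative of \<open>f\<close>
  is continuous on [0,1] and vanishes where \<open>a\<close> does.\<close>

lemma has_value_at_mult_zero:
  assumes "continuous_on {0..1} a" "a x0 = 0" "has_value_at f y c"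
  shows "has_value_at (\<lambda>x. a x * f x) x0 0"
proof -
  obtain w where w: "continuous_on {0..1} w" "AE y in leb01. f y = w y"
    using assms(3) unfolding has_value_at_def by blast
  show ?thesis
    unfolding has_value_at_def
    using w assms by (intro exI[of _ "\<lambda>x. a x * w x"]) (auto intro: continuous_on_mult)
qed

theorem proposition3p1:
  fixes a :: "real \<Rightarrow> real" and x0 :: real
  assumes "continuous_on {0..1} a"
    and "\<forall>x\<in>{0..1}. 0 \<le> a x"
    and "x0 \<in> {0..1}"
    and "a x0 = 0"
    and "\<forall>x\<in>{0..1} - {x0}. 0 < a x"
    and "(\<lambda>x. 1 / a x) \<in> L1"
  shows "(\<forall>i\<in>{1, 2}. Hw a i = H0 i \<and> equivalent_norms_on (H0 i) (H_norm i) (Hw_norm a i)) \<and>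
         (\<forall>u\<in>H0 2. has_value_at (\<lambda>x. a x * u x) x0 0 \<and>
                    has_value_at (\<lambda>x. a x * weak_deriv 1 u x) x0 0)"
proof (intro conjI ballI)
  have inv_a: "integrable leb01 (\<lambda>x. 1 / a x)" and a_nonneg: "\<And>x. x \<in> {0<..<1} \<Longrightarrow> 0 \<le> a x"
    using assms by (auto simp: L1_def)
  define K where "K = (\<integral>x. 1 / a x \<partial>leb01)"
  have K: "0 \<le> K"
    unfolding K_def using a_nonneg by (intro integral_nonneg_AE AE_I2) simp
  fix i :: nat assume i: "i \<in> {1, 2}"
  have L2w: "u \<in> L2w a" "(L2w_norm a u)\<^sup>2 \<le> (L2_norm (weak_deriv i u))\<^sup>2 * K"
    if u: "u \<in> H0 i" for u
  proof -
    have "u \<in> L2" using u by (auto simp: H0_def H_def)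
    from AE_bounded_weighted_L2[OF this H0_top_order_bounds(1)[OF u i] inv_a a_nonneg]
    show "u \<in> L2w a" "(L2w_norm a u)\<^sup>2 \<le> (L2_norm (weak_deriv i u))\<^sup>2 * K"
      by (auto simp: K_def)
  qed
  then show "Hw a i = H0 i"
    by (auto simp: Hw_def)
  \<comment> \<open>Both norms are compared with the top-order norm \<open>m\<close>. In the upper
    constant, \<open>K\<close> comes from the weighted term and 1 from the derivative term.\<close>
  have "1 / sqrt 3 * H_norm i u \<le> Hw_norm a i u \<and> Hw_norm a i u \<le> sqrt (K + 1) * H_norm i u"
    if u: "u \<in> H0 i" for u
  proof -
    define m where "m = L2_norm (weak_deriv i u)"
    note m = H0_H_norm_bounds[OF u i, folded m_def]
    have "m \<le> Hw_norm a i u"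
      unfolding Hw_norm_def m_def by (rule real_le_rsqrt) simp
    moreover have "1 / sqrt 3 * H_norm i u \<le> m"
      using m(2) by (simp add: field_simps)
    moreover have "(L2w_norm a u)\<^sup>2 + m\<^sup>2 \<le> (K + 1) * m\<^sup>2"
      using L2w(2)[OF u] by (simp add: m_def algebra_simps)
    then have "Hw_norm a i u \<le> sqrt ((K + 1) * m\<^sup>2)"
      unfolding Hw_norm_def m_def by (rule real_sqrt_le_mono)
    then have "Hw_norm a i u \<le> sqrt (K + 1) * m"
      by (simp add: real_sqrt_mult m_def L2_norm_nonneg)
    moreover have "sqrt (K + 1) * m \<le> sqrt (K + 1) * H_norm i u"
      using m(1) K by (intro mult_left_mono) auto
    ultimately show ?thesis by linarith
  qed
  then show "equivalent_norms_on (H0 i) (H_norm i) (Hw_norm a i)"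
    unfolding equivalent_norms_on_def
    using K by (intro exI[of _ "1 / sqrt 3"] exI[of _ "sqrt (K + 1)"]) auto
next
  fix u assume u: "u \<in> H0 2"
  \<comment> \<open>The boundary value at 0 supplies the continuous representative of
    \<open>u\<close> on all of [0,1].\<close>
  show "has_value_at (\<lambda>x. a x * u x) x0 0"
    using has_value_at_mult_zero[OF assms(1,4) H0_value_at_0[OF u]] by simp
  have "has_value_at (weak_deriv 1 u) 0 0"
    using u by (simp add: H0_def)
  then show "has_value_at (\<lambda>x. a x * weak_deriv 1 u x) x0 0"
    by (rule has_value_at_mult_zero[OF assms(1,4)])
qed

end
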